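(* Let $R$ be a unital ring which is generated by its commutators as an ideal, and let $n>1$ be a positive integer. Then $R=[R,R]^n$, and there exists $N\in\mathbb N$ such that every $x\in R$ can be written as $x=a_1+\cdots+a_N$ for some $a_i\in[R,R]^{[n]}$.
   Context: Rings are associative. A commutator is an element $[a,b]=ab-ba$ with $a,b\in R$; $R$ is generated by its commutators as an ideal if the two-sided ideal generated by all commutators equals $R$. $[R,R]^{[n]}=\{[a_1,b_1][a_2,b_2]\cdots[a_n,b_n]\mid a_i,b_i\in R\}$ is the set of all products of $n$ commutators, and $[R,R]^n$ is the additive subgroup of $R$ generated by $[R,R]^{[n]}$. *)

theory Defs
  imports "HOL-Algebra.Algebra"
begin

definition commutator :: "('a, 'm) ring_scheme \<Rightarrow> 'a \<Rightarrow> 'a \<Rightarrow> 'a" where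
  "commutator R a b = a \<otimes>\<^bsub>R\<^esub> b \<ominus>\<^bsub>R\<^esub> b \<otimes>\<^bsub>R\<^esub> a"

definition commutators :: "('a, 'm) ring_scheme \<Rightarrow> 'a set" where
  "commutators R = {commutator R a b | a b. a \<in> carrier R \<and> b \<in> carrier R}"

text \<open>The set \<open>[R,R]\<^sup>[\<^sup>n\<^sup>]\<close> of products (in the given order) of exactly \<open>n\<close> commutators.\<close>

definition commutator_products :: "('a, 'm) ring_scheme \<Rightarrow> nat \<Rightarrow> 'a set" where
  "commutator_products R n =
     {foldr (\<otimes>\<^bsub>R\<^esub>) cs \<one>\<^bsub>R\<^esub> | cs. length cs = n \<and> set cs \<subseteq> commutators R}"

text \<open>The additive subgroup \<open>[R,R]\<^sup>n\<close> generated by \<open>[R,R]\<^sup>[\<^sup>n\<^sup>]\<close>; it is not the set of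
  \<open>n\<close>-fold products, nor an ideal power.\<close>

definition commutator_power :: "('a, 'm) ring_scheme \<Rightarrow> nat \<Rightarrow> 'a set" where
  "commutator_power R n = generate (add_monoid R) (commutator_products R n)"

end

theory Submission
  imports Defs
begin

text \<open>Write \<open>L\<close> for the set of commutators. Call \<open>t \<in> R\<close> bounded if there is a single \<open>N\<close> such
  that every \<open>r t s\<close> is a sum of \<open>N\<close> products of two commutators. The bounded elements form an
  ideal \<open>K\<close>, and \<open>K\<close> contains every \<open>[u v, w]\<close> with \<open>u, v, w \<in> L\<close>, because
  \<open>[c, w] t = [c, w t] - w [c, t]\<close> and the derivations \<open>[c, _]\<close> for \<open>c = u v\<close> and \<open>[r, _]\<close> satisfy
  the Leibniz rule.

  If \<open>K\<close> were proper, it would lie in a maximal ideal \<open>M\<close>, and \<open>R / M\<close> would be a prime ring in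
  which \<open>L L\<close> commutes with \<open>L\<close>. In such a ring \<open>[r, s] t [c, r] = 0\<close> for all \<open>c \<in> L L\<close>, so \<open>L L\<close>
  is central; then \<open>u\<^sup>2 = 0\<close> for each \<open>u \<in> L\<close>, then \<open>L L = 0\<close>, and finally \<open>u R u = 0\<close>, so
  \<open>L = 0\<close>. This contradicts that \<open>L\<close> generates \<open>R\<close>. Hence \<open>1 \<in> K\<close>, which is the case \<open>n = 2\<close>.
  The other cases follow by repeatedly replacing one factor by a sum of products of two
  commutators.\<close>

section \<open>Commutator identities\<close>

context ring
begin

lemma commutator_closed [simp]:
  "\<lbrakk>a \<in> carrier R; b \<in> carrier R\<rbrakk> \<Longrightarrow> commutator R a b \<in> carrier R"
  by (simp add: commutator_def)

lemma commutators_subset: "commutators R \<subseteq> carrier R"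
  by (auto simp: commutators_def)

lemma commutators_carrier [simp]: "u \<in> commutators R \<Longrightarrow> u \<in> carrier R"
  using commutators_subset by blast

lemma commutator_in_commutators [simp]:
  "\<lbrakk>a \<in> carrier R; b \<in> carrier R\<rbrakk> \<Longrightarrow> commutator R a b \<in> commutators R"
  unfolding commutators_def by blast

lemma commutator_swap:
  "\<lbrakk>a \<in> carrier R; b \<in> carrier R\<rbrakk> \<Longrightarrow> \<ominus> commutator R a b = commutator R b a"
  unfolding commutator_def by algebra

lemma commutator_mult_right:
  "\<lbrakk>a \<in> carrier R; b \<in> carrier R; c \<in> carrier R\<rbrakk> \<Longrightarrow>
    commutator R a (b \<otimes> c) = commutator R a b \<otimes> c \<oplus> b \<otimes> commutator R a c"
  unfolding commutator_def by algebra

lemma commutator_add_right: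
  "\<lbrakk>a \<in> carrier R; b \<in> carrier R; c \<in> carrier R\<rbrakk> \<Longrightarrow>
    commutator R a (b \<oplus> c) = commutator R a b \<oplus> commutator R a c"
  unfolding commutator_def by algebra

lemma commutator_zero_right: "a \<in> carrier R \<Longrightarrow> commutator R a \<zero> = \<zero>"
  unfolding commutator_def by algebra

lemma uminus_in_commutators:
  assumes "u \<in> commutators R" shows "\<ominus> u \<in> commutators R"
proof -
  obtain a b where "a \<in> carrier R" "b \<in> carrier R" "u = commutator R a b"
    using assms unfolding commutators_def by blast
  then show ?thesis by (simp add: commutator_swap)
qed

section \<open>Sums of exactly \<open>k\<close> elements of a set\<close>

primrec nsums :: "'a set \<Rightarrow> nat \<Rightarrow> 'a set" where
  "nsums A 0 = {\<zero>}"
| "nsums A (Suc k) = {x \<oplus> y | x y. x \<in> nsums A k \<and> y \<in> A}"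

lemma nsums_carrier: "A \<subseteq> carrier R \<Longrightarrow> nsums A k \<subseteq> carrier R"
  by (induction k) auto

lemma nsums_1: "A \<subseteq> carrier R \<Longrightarrow> nsums A (Suc 0) = A"
  by force

lemma nsums_add:
  assumes "A \<subseteq> carrier R" "x \<in> nsums A k" "y \<in> nsums A l"
  shows "x \<oplus> y \<in> nsums A (k + l)"
  using assms(3)
proof (induction l arbitrary: y)
  case 0
  then show ?case using assms(2) nsums_carrier[OF assms(1), of k] by auto
next
  case (Suc l)
  then obtain p q where pq: "p \<in> nsums A l" "q \<in> A" "y = p \<oplus> q" by auto
  then have "x \<oplus> y = (x \<oplus> p) \<oplus> q"
    using assms(1,2) nsums_carrier by (metis a_assoc subsetD)
  then show ?case using Suc.IH pq by auto
qed

text \<open>An additive map that turns each summand into \<open>m\<close> summands multiplies the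
  count by \<open>m\<close>. It serves below for \<open>commutator R r\<close>, for right
  multiplication and for the identity map.\<close>

lemma nsums_map:
  assumes "A \<subseteq> carrier R" "B \<subseteq> carrier R"
    and "\<And>x y. \<lbrakk>x \<in> carrier R; y \<in> carrier R\<rbrakk> \<Longrightarrow> f (x \<oplus> y) = f x \<oplus> f y" "f \<zero> = \<zero>"
    and "\<And>a. a \<in> A \<Longrightarrow> f a \<in> nsums B m"
    and "x \<in> nsums A k"
  shows "f x \<in> nsums B (k * m)"
  using assms(6)
proof (induction k arbitrary: x)
  case 0
  then show ?case using assms(4) by simp
next
  case (Suc k)
  then obtain p q where pq: "p \<in> nsums A k" "q \<in> A" "x = p \<oplus> q" by auto
  then have "f x = f p \<oplus> f q"
    using assms(1,3) nsums_carrier by blast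
  moreover have "f p \<oplus> f q \<in> nsums B (k * m + m)"
    using Suc.IH assms(2,5) pq by (intro nsums_add) auto
  ultimately show ?case by (simp add: add.commute)
qed

lemma nsums_finsum:
  assumes "A \<subseteq> carrier R" "x \<in> nsums A k"
  shows "\<exists>a. (\<forall>i \<in> {1..k}. a i \<in> A) \<and> x = (\<Oplus>i \<in> {1..k}. a i)"
  using assms(2)
proof (induction k arbitrary: x)
  case 0
  then show ?case by simp
next
  case (Suc k)
  then obtain p q where pq: "p \<in> nsums A k" "q \<in> A" "x = p \<oplus> q" by auto
  obtain a where a: "\<forall>i \<in> {1..k}. a i \<in> A" "p = (\<Oplus>i \<in> {1..k}. a i)"
    using Suc.IH pq(1) by blast
  let ?b = "a(Suc k := q)"
  have b: "?b i \<in> A" if "i \<in> {1..Suc k}" for i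
    using that a(1) pq(2) by auto
  have "finsum R ?b {1..k} = finsum R a {1..k}"
    using a(1) assms(1) by (intro finsum_cong') auto
  moreover have "finsum R ?b (insert (Suc k) {1..k}) = ?b (Suc k) \<oplus> finsum R ?b {1..k}"
    using a(1) pq(2) assms(1) by (intro finsum_insert) auto
  moreover have "insert (Suc k) {1..k} = {1..Suc k}" by auto
  moreover have "q \<in> carrier R" "p \<in> carrier R"
    using pq assms(1) nsums_carrier by blast+
  ultimately have "x = finsum R ?b {1..Suc k}"
    using a(2) pq(3) a_comm by simp
  then show ?case using b by blast
qed

lemma nsums_generate:
  "x \<in> nsums A k \<Longrightarrow> x \<in> generate (add_monoid R) A"
proof (induction k arbitrary: x)
  case 0
  then show ?case using generate.one[of "add_monoid R" A] by simp
next
  case (Suc k)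
  then show ?case
    using generate.eng[of _ "add_monoid R" A] generate.incl[of _ A "add_monoid R"] by auto
qed

section \<open>Products of \<open>n\<close> commutators\<close>

lemma commutator_products_0: "commutator_products R 0 = {\<one>}"
  by (simp add: commutator_products_def)

lemma commutator_products_Suc:
  "commutator_products R (Suc n) =
    {u \<otimes> p | u p. u \<in> commutators R \<and> p \<in> commutator_products R n}"
proof (intro Set.set_eqI iffI)
  fix x assume "x \<in> commutator_products R (Suc n)"
  then obtain cs where cs: "length cs = Suc n" "set cs \<subseteq> commutators R" "x = foldr (\<otimes>) cs \<one>"
    by (auto simp: commutator_products_def)
  then obtain u ds where "cs = u # ds" by (cases cs) auto
  then show "x \<in> {u \<otimes> p | u p. u \<in> commutators R \<and> p \<in> commutator_products R n}"
    using cs by (auto simp: commutator_products_def)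
next
  fix x assume "x \<in> {u \<otimes> p | u p. u \<in> commutators R \<and> p \<in> commutator_products R n}"
  then obtain u ds where "u \<in> commutators R" "length ds = n" "set ds \<subseteq> commutators R"
    "x = u \<otimes> foldr (\<otimes>) ds \<one>"
    by (auto simp: commutator_products_def)
  then show "x \<in> commutator_products R (Suc n)"
    by (auto simp: commutator_products_def intro!: exI[of _ "u # ds"])
qed

lemma commutator_products_carrier: "commutator_products R n \<subseteq> carrier R"
  by (induction n) (auto simp: commutator_products_0 commutator_products_Suc)

lemma commutator_products_2:
  "commutator_products R 2 = {u \<otimes> v | u v. u \<in> commutators R \<and> v \<in> commutators R}"
  by (force simp: numeral_2_eq_2 commutator_products_0 commutator_products_Suc)

section \<open>Sums of products of two commutators; the ideal of bounded elements\<close>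

lemma mult_commutators_nsums:
  "\<lbrakk>u \<in> commutators R; v \<in> commutators R\<rbrakk> \<Longrightarrow> u \<otimes> v \<in> nsums (commutator_products R 2) 1"
  unfolding One_nat_def nsums_1[OF commutator_products_carrier] unfolding commutator_products_2 by blast

lemmas nsums2_add = nsums_add[OF commutator_products_carrier[of 2]]

text \<open>Leibniz rule: \<open>[r, u v] = [r, u] v + u [r, v]\<close>, and each term is a product
  of two commutators.\<close>

lemma commutator_with_product_nsums:
  assumes "r \<in> carrier R" "u \<in> commutators R" "v \<in> commutators R"
  shows "commutator R r (u \<otimes> v) \<in> nsums (commutator_products R 2) 2"
proof -
  have "commutator R r u \<otimes> v \<oplus> u \<otimes> commutator R r v \<in> nsums (commutator_products R 2) (1 + 1)"
    using assms by (intro nsums2_add mult_commutators_nsums) auto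
  then show ?thesis using assms by (simp add: commutator_mult_right numeral_2_eq_2)
qed

lemma commutator_with_nsums:
  assumes "r \<in> carrier R" "x \<in> nsums (commutator_products R 2) k"
  shows "commutator R r x \<in> nsums (commutator_products R 2) (k * 2)"
proof (rule nsums_map[OF commutator_products_carrier commutator_products_carrier _ _ _ assms(2)])
  fix a assume "a \<in> commutator_products R 2"
  then obtain u v where "u \<in> commutators R" "v \<in> commutators R" "a = u \<otimes> v"
    unfolding commutator_products_2 by blast
  then show "commutator R r a \<in> nsums (commutator_products R 2) 2"
    using commutator_with_product_nsums[OF assms(1)] by blast
qed (use assms(1) in \<open>simp_all add: commutator_add_right commutator_zero_right\<close>)

text \<open>\<open>N\<close> may depend on \<open>t\<close> but not on \<open>r\<close> and
  \<open>s\<close>; so boundedness of \<open>\<one>\<close> yields one \<open>N\<close> for the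
  whole ring.\<close>

definition bounded_elements :: "'a set" where
  "bounded_elements = {t \<in> carrier R. \<exists>N. \<forall>r \<in> carrier R. \<forall>s \<in> carrier R.
     r \<otimes> t \<otimes> s \<in> nsums (commutator_products R 2) N}"

text \<open>Signs and outer factors are absorbed into \<open>r\<close> or \<open>s\<close>, which
  keeps \<open>N\<close>; for a sum of two elements the bounds add up.\<close>

lemma ideal_bounded_elements: "ideal bounded_elements R"
proof (rule idealI[OF ring_axioms])
  let ?S = "nsums (commutator_products R 2)"
  show "subgroup bounded_elements (add_monoid R)"
  proof (rule add.subgroupI)
    show "bounded_elements \<subseteq> carrier R" by (auto simp: bounded_elements_def)
    have "\<zero> \<in> bounded_elements"
      by (auto simp: bounded_elements_def intro!: exI[of _ 0])
    then show "bounded_elements \<noteq> {}" by blast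
  next
    fix a assume "a \<in> bounded_elements"
    then obtain N where a: "a \<in> carrier R" and
      N: "\<And>r s. \<lbrakk>r \<in> carrier R; s \<in> carrier R\<rbrakk> \<Longrightarrow> r \<otimes> a \<otimes> s \<in> ?S N"
      by (auto simp: bounded_elements_def)
    have "r \<otimes> (\<ominus> a) \<otimes> s \<in> ?S N" if "r \<in> carrier R" "s \<in> carrier R" for r s
      using N[of "\<ominus> r" s] that a by (simp add: l_minus r_minus)
    then show "\<ominus> a \<in> bounded_elements" using a by (auto simp: bounded_elements_def)
  next
    fix a b assume "a \<in> bounded_elements" "b \<in> bounded_elements"
    then obtain N N' where a: "a \<in> carrier R" "b \<in> carrier R" and
      N: "\<forall>r \<in> carrier R. \<forall>s \<in> carrier R. r \<otimes> a \<otimes> s \<in> ?S N"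
        "\<forall>r \<in> carrier R. \<forall>s \<in> carrier R. r \<otimes> b \<otimes> s \<in> ?S N'"
      unfolding bounded_elements_def by blast
    have "r \<otimes> (a \<oplus> b) \<otimes> s \<in> ?S (N + N')" if "r \<in> carrier R" "s \<in> carrier R" for r s
      using nsums2_add[of "r \<otimes> a \<otimes> s" N "r \<otimes> b \<otimes> s" N'] N that a by (simp add: l_distr r_distr)
    then show "a \<oplus> b \<in> bounded_elements" using a by (auto simp: bounded_elements_def)
  qed
next
  fix a x assume "a \<in> bounded_elements" and x: "x \<in> carrier R"
  then obtain N where a: "a \<in> carrier R" and
    N: "\<And>r s. \<lbrakk>r \<in> carrier R; s \<in> carrier R\<rbrakk> \<Longrightarrow>
      r \<otimes> a \<otimes> s \<in> nsums (commutator_products R 2) N"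
    by (auto simp: bounded_elements_def)
  have "r \<otimes> (x \<otimes> a) \<otimes> s \<in> nsums (commutator_products R 2) N"
    if "r \<in> carrier R" "s \<in> carrier R" for r s
    using N[of "r \<otimes> x" s] a x that by (simp add: m_assoc)
  then show "x \<otimes> a \<in> bounded_elements"
    using a x by (auto simp: bounded_elements_def)
  have "r \<otimes> (a \<otimes> x) \<otimes> s \<in> nsums (commutator_products R 2) N"
    if "r \<in> carrier R" "s \<in> carrier R" for r s
    using N[of r "x \<otimes> s"] a x that by (simp add: m_assoc)
  then show "a \<otimes> x \<in> bounded_elements"
    using a x by (auto simp: bounded_elements_def)
qed

lemma commutator_product_bounded:
  assumes "u \<in> commutators R" "v \<in> commutators R" "w \<in> commutators R"
  shows "commutator R (u \<otimes> v) w \<in> bounded_elements"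
proof -
  let ?S = "nsums (commutator_products R 2)" and ?c = "u \<otimes> v"
  have carr: "?c \<in> carrier R" "w \<in> carrier R" using assms by auto
  have *: "commutator R ?c w \<otimes> t \<in> ?S 3" if t: "t \<in> carrier R" for t
  proof -
    \<comment> \<open>This is \<open>[c, w] t = [c, w t] - w [c, t]\<close> with the signs moved
      inside: the product \<open>c\<close> becomes the second argument, giving two summands, and
      \<open>- w\<close> is again a commutator, giving one.\<close>
    have eq: "commutator R ?c w \<otimes> t = commutator R (\<ominus> (w \<otimes> t)) ?c \<oplus> (\<ominus> w) \<otimes> commutator R ?c t"
      using carr t unfolding commutator_def by algebra
    have "commutator R (\<ominus> (w \<otimes> t)) ?c \<in> ?S 2"
      using assms t by (intro commutator_with_product_nsums) auto
    moreover have "(\<ominus> w) \<otimes> commutator R ?c t \<in> ?S 1"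
      using assms t carr by (intro mult_commutators_nsums uminus_in_commutators) auto
    ultimately have "commutator R ?c w \<otimes> t \<in> ?S (2 + 1)"
      unfolding eq by (rule nsums2_add)
    then show ?thesis by simp
  qed
  have "r \<otimes> commutator R ?c w \<otimes> s \<in> ?S 9" if "r \<in> carrier R" "s \<in> carrier R" for r s
  proof -
    \<comment> \<open>Moving \<open>r\<close> to the right end costs \<open>[r, [c, w] s]\<close>.
      The first term has 3 summands; the second is a derivation applied to 3 summands, which doubles
      them.\<close>
    have eq: "r \<otimes> commutator R ?c w \<otimes> s =
        commutator R ?c w \<otimes> (s \<otimes> r) \<oplus> commutator R r (commutator R ?c w \<otimes> s)"
      using carr that unfolding commutator_def by algebra
    have "r \<otimes> commutator R ?c w \<otimes> s \<in> ?S (3 + 3 * 2)"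
      unfolding eq using that by (intro nsums2_add * commutator_with_nsums) auto
    then show ?thesis by simp
  qed
  then show ?thesis using carr by (auto simp: bounded_elements_def)
qed

end

section \<open>Prime and maximal two-sided ideals\<close>

lemma (in ideal) diff_mem: "\<lbrakk>a \<in> I; b \<in> I\<rbrakk> \<Longrightarrow> a \<ominus> b \<in> I"
  by (simp add: minus_eq)

text \<open>The argument for the prime quotient, carried out as congruences modulo \<open>I\<close>;
  primeness is the noncommutative condition on \<open>a R b\<close>.\<close>

lemma (in ideal) prime_commutators_subset:
  assumes prime: "\<And>a b. \<lbrakk>a \<in> carrier R; b \<in> carrier R; \<And>r. r \<in> carrier R \<Longrightarrow> a \<otimes> r \<otimes> b \<in> I\<rbrakk>
      \<Longrightarrow> a \<in> I \<or> b \<in> I"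
    and comm: "\<And>u v w. \<lbrakk>u \<in> commutators R; v \<in> commutators R; w \<in> commutators R\<rbrakk>
      \<Longrightarrow> commutator R (u \<otimes> v) w \<in> I"
  shows "commutators R \<subseteq> I"
proof -
  have central: "commutator R (u \<otimes> v) r \<in> I"
    if uv: "u \<in> commutators R" "v \<in> commutators R" and r: "r \<in> carrier R" for u v r
  proof -
    define c where "c = u \<otimes> v"
    have c: "c \<in> carrier R" using uv by (simp add: c_def)
    have comm_c: "commutator R c w \<in> I" if "w \<in> commutators R" for w
      using comm[OF uv that] by (simp add: c_def)
    have 1: "commutator R r s \<otimes> commutator R c r \<in> I" if s: "s \<in> carrier R" for s
    proof -
      \<comment> \<open>Apply the derivation \<open>[c, _]\<close> to
        \<open>[r, s r] = [r, s] r\<close>; \<open>c\<close> commutes modulo \<open>I\<close> with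
        both commutators \<open>[r, s r]\<close> and \<open>[r, s]\<close>.\<close>
      have "commutator R r s \<otimes> commutator R c r =
          commutator R c (commutator R r (s \<otimes> r)) \<ominus> commutator R c (commutator R r s) \<otimes> r"
        using c r s unfolding commutator_def by algebra
      then show ?thesis using comm_c r s by (simp add: diff_mem I_r_closed)
    qed
    have "commutator R c r \<otimes> t \<otimes> commutator R c r \<in> I" if t: "t \<in> carrier R" for t
    proof -
      \<comment> \<open>Since \<open>[r, c t] = [r, c] t + c [r, t]\<close>, the factor
        \<open>[c, r] t\<close> equals \<open>c [r, t] - [r, c t]\<close>; fact \<open>1\<close>
        then handles both terms.\<close>
      have "commutator R c r \<otimes> t \<otimes> commutator R c r =
          c \<otimes> (commutator R r t \<otimes> commutator R c r) \<ominus> commutator R r (c \<otimes> t) \<otimes> commutator R c r"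
        using c r t unfolding commutator_def by algebra
      moreover have "c \<otimes> (commutator R r t \<otimes> commutator R c r) \<in> I"
        by (rule I_l_closed[OF 1[OF t] c])
      moreover have "commutator R r (c \<otimes> t) \<otimes> commutator R c r \<in> I"
        using c t by (intro 1) simp
      ultimately show ?thesis by (simp add: diff_mem)
    qed
    then show ?thesis
      unfolding c_def[symmetric]
      using prime[OF commutator_closed[OF c r] commutator_closed[OF c r]] by blast
  qed
  have square: "u \<otimes> u \<in> I" if u: "u \<in> commutators R" for u
  proof -
    obtain x y where xy: "x \<in> carrier R" "y \<in> carrier R" "u = commutator R x y"
      using u unfolding commutators_def by blast
    have uc: "u \<in> carrier R" using u by simp
    \<comment> \<open>As \<open>x u\<close> is a commutator too, both \<open>x u u\<close> and
      \<open>u u\<close> are central modulo \<open>I\<close>; expanding \<open>[x u u, y]\<close>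
      leaves \<open>[x, y] u u = u u u\<close> in \<open>I\<close>.\<close>
    have xu: "x \<otimes> u \<in> commutators R"
    proof -
      have "x \<otimes> u = commutator R x (x \<otimes> y)"
        unfolding xy(3) commutator_def using xy(1,2) by algebra
      then show ?thesis using xy by simp
    qed
    have 1: "u \<otimes> (u \<otimes> u) \<in> I"
    proof -
      have "commutator R x y \<otimes> (u \<otimes> u) =
          commutator R (x \<otimes> u \<otimes> u) y \<ominus> x \<otimes> commutator R (u \<otimes> u) y"
        using uc xy(1,2) unfolding commutator_def by algebra
      then show ?thesis
        using central[OF xu u xy(2)] central[OF u u xy(2)] xy by (simp add: diff_mem I_l_closed)
    qed
    \<comment> \<open>Centrality moves \<open>u u\<close> past \<open>r\<close>, leaving
      \<open>u u u r\<close>. Primeness gives \<open>u\<close> or \<open>u u\<close> in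
      \<open>I\<close>, and either suffices.\<close>
    have "u \<otimes> r \<otimes> (u \<otimes> u) \<in> I" if r: "r \<in> carrier R" for r
    proof -
      have "u \<otimes> r \<otimes> (u \<otimes> u) = u \<otimes> (u \<otimes> u) \<otimes> r \<ominus> u \<otimes> commutator R (u \<otimes> u) r"
        using uc r unfolding commutator_def by algebra
      moreover have "u \<otimes> (u \<otimes> u) \<otimes> r \<in> I" by (rule I_r_closed[OF 1 r])
      moreover have "u \<otimes> commutator R (u \<otimes> u) r \<in> I"
        by (rule I_l_closed[OF central[OF u u r] uc])
      ultimately show ?thesis by (simp add: diff_mem)
    qed
    then show ?thesis using prime[OF uc m_closed[OF uc uc]] I_l_closed[OF _ uc] by blast
  qed
  have mult: "u \<otimes> v \<in> I" if uv: "u \<in> commutators R" "v \<in> commutators R" for u v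
  proof -
    have c: "u \<in> carrier R" "v \<in> carrier R" using uv by auto
    have "u \<otimes> r \<otimes> (u \<otimes> v) \<in> I" if r: "r \<in> carrier R" for r
    proof -
      \<comment> \<open>Centrality of \<open>u v\<close> moves it to the left of \<open>r\<close>,
        producing the factor \<open>u u\<close>, already in \<open>I\<close>.\<close>
      have "u \<otimes> r \<otimes> (u \<otimes> v) = (u \<otimes> u) \<otimes> (v \<otimes> r) \<ominus> u \<otimes> commutator R (u \<otimes> v) r"
        using c r unfolding commutator_def by algebra
      moreover have "(u \<otimes> u) \<otimes> (v \<otimes> r) \<in> I"
        using c r by (intro I_r_closed[OF square[OF uv(1)]]) simp
      moreover have "u \<otimes> commutator R (u \<otimes> v) r \<in> I"
        by (rule I_l_closed[OF central[OF uv r] c(1)])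
      ultimately show ?thesis by (simp add: diff_mem)
    qed
    then show ?thesis using prime[OF c(1) m_closed[OF c]] I_r_closed[OF _ c(2)] by blast
  qed
  have "u \<in> I" if u: "u \<in> commutators R" for u
  proof -
    obtain x y where xy: "x \<in> carrier R" "y \<in> carrier R" "u = commutator R x y"
      using u unfolding commutators_def by blast
    have uc: "u \<in> carrier R" using u by simp
    have "u \<otimes> s \<otimes> u \<in> I" if s: "s \<in> carrier R" for s
    proof -
      \<comment> \<open>Leibniz for \<open>[x, s y]\<close> removes \<open>s\<close> from between
        the two commutators: both resulting terms begin with a product of two commutators.\<close>
      have "u \<otimes> s \<otimes> commutator R x y =
          u \<otimes> commutator R x (s \<otimes> y) \<ominus> u \<otimes> commutator R x s \<otimes> y"
        using uc s xy(1,2) unfolding commutator_def by algebra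
      moreover have "u \<otimes> commutator R x (s \<otimes> y) \<in> I"
        using s xy by (intro mult u) simp
      moreover have "u \<otimes> commutator R x s \<otimes> y \<in> I"
        using s xy by (intro I_r_closed mult u) simp_all
      ultimately show ?thesis using xy(3) by (simp add: diff_mem)
    qed
    then show ?thesis using prime[OF uc uc] by blast
  qed
  then show ?thesis by blast
qed

text \<open>Modulo \<open>I\<close> this is the left annihilator of the left ideal
  \<open>R b\<close>, hence two-sided.\<close>

lemma (in ideal) ideal_left_annihilator:
  assumes b: "b \<in> carrier R"
  shows "ideal {z \<in> carrier R. \<forall>r \<in> carrier R. z \<otimes> r \<otimes> b \<in> I} R"
proof (rule idealI[OF ring_axioms])
  show "subgroup {z \<in> carrier R. \<forall>r \<in> carrier R. z \<otimes> r \<otimes> b \<in> I} (add_monoid R)"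
    by (rule add.subgroupI)
      (use b in \<open>auto simp: l_distr l_minus intro!: exI[of _ \<zero>]\<close>)
next
  fix a x
  assume a: "a \<in> {z \<in> carrier R. \<forall>r \<in> carrier R. z \<otimes> r \<otimes> b \<in> I}" and x: "x \<in> carrier R"
  have "x \<otimes> a \<otimes> r \<otimes> b \<in> I" if r: "r \<in> carrier R" for r
  proof -
    have "x \<otimes> (a \<otimes> r \<otimes> b) \<in> I" using a r x by (blast intro: I_l_closed)
    then show ?thesis using a b x r by (simp add: m_assoc)
  qed
  then show "x \<otimes> a \<in> {z \<in> carrier R. \<forall>r \<in> carrier R. z \<otimes> r \<otimes> b \<in> I}"
    using a x by simp
  have "a \<otimes> x \<otimes> r \<otimes> b \<in> I" if r: "r \<in> carrier R" for r
  proof -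
    have "a \<otimes> (x \<otimes> r) \<otimes> b \<in> I" using a r x by blast
    then show ?thesis using a b x r by (simp add: m_assoc)
  qed
  then show "a \<otimes> x \<in> {z \<in> carrier R. \<forall>r \<in> carrier R. z \<otimes> r \<otimes> b \<in> I}"
    using a x by simp
qed

text \<open>The annihilator \<open>?A\<close> contains \<open>I\<close> and \<open>a\<close>. If it
  contains \<open>\<one>\<close>, then \<open>b\<close> is in \<open>I\<close>; otherwise maximality
  forces \<open>?A = I\<close>.\<close>

lemma (in ideal) maximal_imp_prime:
  assumes one: "\<one> \<notin> I"
    and max: "\<And>J. \<lbrakk>ideal J R; I \<subseteq> J; \<one> \<notin> J\<rbrakk> \<Longrightarrow> J = I"
    and ab: "a \<in> carrier R" "b \<in> carrier R" "\<And>r. r \<in> carrier R \<Longrightarrow> a \<otimes> r \<otimes> b \<in> I"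
  shows "a \<in> I \<or> b \<in> I"
proof -
  let ?A = "{z \<in> carrier R. \<forall>r \<in> carrier R. z \<otimes> r \<otimes> b \<in> I}"
  have sub: "I \<subseteq> ?A" using ab(2) by (auto intro: I_r_closed)
  have "a \<in> ?A" using ab by simp
  show ?thesis
  proof (cases "\<one> \<in> ?A")
    case True
    then have "\<one> \<otimes> \<one> \<otimes> b \<in> I" by blast
    then show ?thesis using ab(2) by simp
  next
    case False
    then have "?A = I" using max[OF ideal_left_annihilator[OF ab(2)] sub] by blast
    then show ?thesis using \<open>a \<in> ?A\<close> by blast
  qed
qed

lemma (in ring) exists_maximal_ideal:
  assumes "ideal I R" "\<one> \<notin> I"
  obtains M where "ideal M R" "I \<subseteq> M" "\<one> \<notin> M"
    "\<And>J. \<lbrakk>ideal J R; M \<subseteq> J; \<one> \<notin> J\<rbrakk> \<Longrightarrow> J = M"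
proof -
  let ?P = "{J. ideal J R \<and> I \<subseteq> J \<and> \<one> \<notin> J}"
  have "\<exists>M \<in> ?P. \<forall>J \<in> ?P. M \<subseteq> J \<longrightarrow> J = M"
  proof (rule subset_Zorn)
    fix C assume C: "subset.chain ?P C"
    show "\<exists>U \<in> ?P. \<forall>J \<in> C. J \<subseteq> U"
    \<comment> \<open>The empty chain has an empty union, which is no ideal; there \<open>I\<close>
      itself is the upper bound.\<close>
    proof (cases "C = {}")
      case True
      then show ?thesis using assms by blast
    next
      case False
      have "subset.chain {J. ideal J R} C"
        using C by (auto simp: pred_on.chain_def)
      then have "ideal (\<Union>C) R"
        using chain_Union_is_ideal[of C] False by simp
      then have "\<Union>C \<in> ?P"
        using C False by (auto simp: pred_on.chain_def)
      then show ?thesis by blast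
    qed
  qed
  then obtain M where M: "M \<in> ?P" "\<forall>J \<in> ?P. M \<subseteq> J \<longrightarrow> J = M" by blast
  then have "J = M" if "ideal J R" "M \<subseteq> J" "\<one> \<notin> J" for J
    using that by blast
  then show thesis using that M(1) by blast
qed

section \<open>Uniform bounds for all \<open>n \<ge> 2\<close>\<close>

context ring
begin

lemma one_bounded:
  assumes gen: "Idl (commutators R) = carrier R"
  shows "\<one> \<in> bounded_elements"
proof (rule ccontr)
  assume "\<one> \<notin> bounded_elements"
  then obtain M where M: "ideal M R" "bounded_elements \<subseteq> M" "\<one> \<notin> M"
    "\<And>J. \<lbrakk>ideal J R; M \<subseteq> J; \<one> \<notin> J\<rbrakk> \<Longrightarrow> J = M"
    using exists_maximal_ideal[OF ideal_bounded_elements] by metis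
  interpret M: ideal M R by fact
  have "commutators R \<subseteq> M"
  proof (rule M.prime_commutators_subset)
    show "a \<in> M \<or> b \<in> M"
      if "a \<in> carrier R" "b \<in> carrier R" "\<And>r. r \<in> carrier R \<Longrightarrow> a \<otimes> r \<otimes> b \<in> M" for a b
      using M.maximal_imp_prime[OF M(3,4) that] by blast
  qed (use M(2) commutator_product_bounded in blast)
  then have "carrier R \<subseteq> M"
    using genideal_minimal[OF M(1)] gen by metis
  then show False using M(3) by blast
qed

text \<open>Induction from \<open>n = 2\<close>: the leading factor of a product is itself a sum of
  \<open>N2\<close> products of two commutators, so each product of \<open>n\<close> commutators
  becomes \<open>N2\<close> products of \<open>n + 1\<close>.\<close>

lemma carrier_nsums_commutator_products:
  assumes gen: "Idl (commutators R) = carrier R" and n: "n \<ge> 2"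
  shows "\<exists>N. carrier R \<subseteq> nsums (commutator_products R n) N"
proof -
  obtain N2 where "\<forall>r \<in> carrier R. \<forall>s \<in> carrier R. r \<otimes> \<one> \<otimes> s
      \<in> nsums (commutator_products R 2) N2"
    using one_bounded[OF gen] unfolding bounded_elements_def by blast
  then have N2: "x \<in> nsums (commutator_products R 2) N2" if "x \<in> carrier R" for x
    using that by (metis one_closed r_one)
  show ?thesis
    using n
  proof (induction n rule: dec_induct)
    case base
    then show ?case using N2 by blast
  next
    case (step n)
    then obtain N where N: "carrier R \<subseteq> nsums (commutator_products R n) N" by blast
    have "p \<in> nsums (commutator_products R (Suc n)) N2"
      if p: "p \<in> commutator_products R n" for p
    proof -
      obtain m where m: "n = Suc m" using step.hyps by (cases n) auto
      obtain u q where uq: "u \<in> commutators R" "q \<in> commutator_products R m" "p = u \<otimes> q"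
        using p unfolding m commutator_products_Suc by blast
      have q: "q \<in> carrier R" using uq(2) commutator_products_carrier by blast
      \<comment> \<open>Right multiplication by \<open>q\<close> sends each \<open>v w\<close> to a
        single longer product, hence the factor 1.\<close>
      have "u \<otimes> q \<in> nsums (commutator_products R (Suc n)) (N2 * 1)"
      proof (rule nsums_map[where f = "\<lambda>x. x \<otimes> q", OF commutator_products_carrier
            commutator_products_carrier _ _ _ N2])
        fix a assume "a \<in> commutator_products R 2"
        then obtain v w where vw: "v \<in> commutators R" "w \<in> commutators R" "a = v \<otimes> w"
          unfolding commutator_products_2 by blast
        then have "a \<otimes> q = v \<otimes> (w \<otimes> q)" using q by (simp add: m_assoc)
        then have "a \<otimes> q \<in> commutator_products R (Suc n)"
          using vw uq(2) unfolding m commutator_products_Suc by blast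
        then show "a \<otimes> q \<in> nsums (commutator_products R (Suc n)) 1"
          by (simp only: One_nat_def nsums_1[OF commutator_products_carrier])
      qed (use q uq(1) in \<open>auto simp: l_distr\<close>)
      then show ?thesis using uq(3) by simp
    qed
    \<comment> \<open>With the identity map, \<open>nsums_map\<close> merely replaces each of the
      \<open>N\<close> summands by \<open>N2\<close> new ones.\<close>
    then have "x \<in> nsums (commutator_products R (Suc n)) (N * N2)" if "x \<in> carrier R" for x
      using nsums_map[OF commutator_products_carrier commutator_products_carrier,
          where f = "\<lambda>x. x"] N that by blast
    then show ?case by blast
  qed
qed

end

theorem theorem10:
  fixes R :: "('a, 'm) ring_scheme" (structure) and n :: nat
  assumes "ring R"
    and "Idl\<^bsub>R\<^esub> (commutators R) = carrier R"
    and "n > 1"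
  shows "carrier R = commutator_power R n \<and>
    (\<exists>N::nat. \<forall>x \<in> carrier R. \<exists>a. (\<forall>i \<in> {1..N}. a i \<in> commutator_products R n) \<and>
        x = (\<Oplus>\<^bsub>R\<^esub> i \<in> {1..N}. a i))"
proof -
  interpret ring R by fact
  \<comment> \<open>This \<open>N\<close> serves both claims: such sums lie in the generated
    additive subgroup and unfold to indexed sums.\<close>
  obtain N where N: "carrier R \<subseteq> nsums (commutator_products R n) N"
    using carrier_nsums_commutator_products[OF assms(2), of n] assms(3) by auto
  have "commutator_power R n \<subseteq> carrier R"
    using add.generate_incl[OF commutator_products_carrier] by (simp add: commutator_power_def)
  moreover have "carrier R \<subseteq> commutator_power R n"
    using N nsums_generate unfolding commutator_power_def by blast
  moreover have "\<forall>x \<in> carrier R. \<exists>a. (\<forall>i \<in> {1..N}. a i \<in> commutator_products R n) \<and>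
      x = (\<Oplus>i \<in> {1..N}. a i)"
    using N nsums_finsum[OF commutator_products_carrier] by blast
  ultimately show ?thesis by blast
qed

end
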